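(* If $G$ is a graph with $\operatorname{mad}(G) < \frac{22}{9}$ and $G$ has no induced $5$-cycle (i.e. no induced subgraph of $G$ is isomorphic to the cycle $C_5$), then $\chi_o(G) \leq 4$.
   Context: All graphs are finite and simple (no loops, no parallel edges). The maximum average degree $\operatorname{mad}(G)$ of a graph $G$ is the maximum of $\frac{2|E(H)|}{|V(H)|}$ over all non-empty subgraphs $H$ of $G$. An odd $c$-coloring of a graph is a proper coloring of its vertices with (at most) $c$ colors such that, for each vertex $v$ of positive degree, some color appears an odd number of times on the neighborhood of $v$. The odd chromatic number $\chi_o(G)$ is the minimum $c$ such that $G$ has an odd $c$-coloring. *)

theory Defs
  imports Complex_Main
begin

text \<open>An edge is the two-element set of its end vertices.\<close>

record 'a ugraph =
  verts :: "'a set"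
  edges :: "'a set set"

definition simple_graph :: "'a ugraph \<Rightarrow> bool" where
  "simple_graph G \<longleftrightarrow>
     finite (verts G) \<and> (\<forall>e \<in> edges G. e \<subseteq> verts G \<and> card e = 2)"

definition neighbourhood :: "'a ugraph \<Rightarrow> 'a \<Rightarrow> 'a set" where
  "neighbourhood G v = {u \<in> verts G. {u, v} \<in> edges G}"

definition degree :: "'a ugraph \<Rightarrow> 'a \<Rightarrow> nat" where
  "degree G v = card (neighbourhood G v)"

definition subgraph :: "'a ugraph \<Rightarrow> 'a ugraph \<Rightarrow> bool" where
  "subgraph H G \<longleftrightarrow> simple_graph H \<and> verts H \<subseteq> verts G \<and> edges H \<subseteq> edges G"

definition induced_subgraph :: "'a ugraph \<Rightarrow> 'a ugraph \<Rightarrow> bool" where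
  "induced_subgraph H G \<longleftrightarrow>
     verts H \<subseteq> verts G \<and> edges H = {e \<in> edges G. e \<subseteq> verts H}"

definition isomorphic :: "'a ugraph \<Rightarrow> 'b ugraph \<Rightarrow> bool" where
  "isomorphic G H \<longleftrightarrow>
     (\<exists>f. bij_betw f (verts G) (verts H) \<and> (\<lambda>e. f ` e) ` edges G = edges H)"

text \<open>This is the cycle of length \<open>n\<close> only for \<open>n \<ge> 3\<close>.\<close>

definition cycle_graph :: "nat \<Rightarrow> nat ugraph" where
  "cycle_graph n = \<lparr>verts = {..<n}, edges = {{i, (i + 1) mod n} | i. i < n}\<rparr>"

text \<open>
  For the graph without vertices the set below is empty, so that its \<open>mad\<close> is
  an unspecified real number.
\<close>

definition mad :: "'a ugraph \<Rightarrow> real" where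
  "mad G = Max {2 * real (card (edges H)) / real (card (verts H)) | H.
                  subgraph H G \<and> verts H \<noteq> {}}"

definition proper_coloring :: "'a ugraph \<Rightarrow> nat \<Rightarrow> ('a \<Rightarrow> nat) \<Rightarrow> bool" where
  "proper_coloring G c f \<longleftrightarrow>
     (\<forall>v \<in> verts G. f v < c) \<and>
     (\<forall>u \<in> verts G. \<forall>v \<in> verts G. {u, v} \<in> edges G \<longrightarrow> f u \<noteq> f v)"

definition odd_coloring :: "'a ugraph \<Rightarrow> nat \<Rightarrow> ('a \<Rightarrow> nat) \<Rightarrow> bool" where
  "odd_coloring G c f \<longleftrightarrow>
     proper_coloring G c f \<and>
     (\<forall>v \<in> verts G. degree G v > 0 \<longrightarrow>
        (\<exists>k < c. odd (card {u \<in> neighbourhood G v. f u = k})))"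

definition odd_chromatic_number :: "'a ugraph \<Rightarrow> nat" where
  "odd_chromatic_number G = (LEAST c. \<exists>f. odd_coloring G c f)"

text \<open>
  The maximum and the minimum above exist: a finite graph has finitely many
  subgraphs, and coloring all vertices differently gives an odd coloring.
\<close>

lemma finite_mad_set:
  assumes "simple_graph G"
  shows "finite {2 * real (card (edges H)) / real (card (verts H)) | H.
                   subgraph H G \<and> verts H \<noteq> {}}" (is "finite ?S")
proof -
  have "edges G \<subseteq> Pow (verts G)"
    using assms by (auto simp: simple_graph_def)
  then have fin: "finite (Pow (verts G) \<times> Pow (edges G))"
    using assms by (auto simp: simple_graph_def intro: finite_subset)
  have "?S \<subseteq> (\<lambda>(W, F). 2 * real (card F) / real (card W)) ` (Pow (verts G) \<times> Pow (edges G))"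
    by (force simp: subgraph_def)
  then show ?thesis
    using fin by (meson finite_imageI finite_subset)
qed

lemma odd_coloring_exists:
  assumes "simple_graph G"
  shows "\<exists>c f. odd_coloring G c f"
proof -
  have fin: "finite (verts G)"
    using assms by (simp add: simple_graph_def)
  obtain f :: "'a \<Rightarrow> nat" and c where img: "f ` verts G = {i. i < c}" and inj: "inj_on f (verts G)"
    using finite_imp_inj_to_nat_seg[OF fin] by blast
  have lt: "f v < c" if "v \<in> verts G" for v
    using that img by blast
  have ne: "f u \<noteq> f v" if "u \<in> verts G" "v \<in> verts G" "{u, v} \<in> edges G" for u v
  proof -
    have "u \<noteq> v"
      using assms that(3) by (auto simp: simple_graph_def)
    then show ?thesis
      using inj that by (auto simp: inj_on_def)
  qed
  have "\<exists>k < c. odd (card {u \<in> neighbourhood G v. f u = k})" if "degree G v > 0" for v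
  proof -
    obtain u where u: "u \<in> neighbourhood G v"
      using \<open>degree G v > 0\<close> by (auto simp: degree_def card_gt_0_iff)
    then have "{w \<in> neighbourhood G v. f w = f u} = {u}"
      using inj by (auto simp: neighbourhood_def inj_on_def)
    moreover have "f u < c"
      using u lt by (simp add: neighbourhood_def)
    ultimately show ?thesis
      by (intro exI[of _ "f u"]) simp
  qed
  then have "odd_coloring G c f"
    using lt ne by (simp add: odd_coloring_def proper_coloring_def)
  then show ?thesis by blast
qed

end

theory Submission
  imports Defs
begin

text \<open>
  Only vertices of even degree restrict an odd coloring, and a vertex of degree 2 only asks that
  its two neighbours differ. In a minimal counterexample all degrees are at least 2, and maximal
  paths of 2-vertices (threads) have at most three vertices: a thread with four vertices is
  reducible unless it closes up to an induced 5-cycle. To reduce a larger configuration, delete a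
  vertex \<open>v\<close> of degree at least 3 together with all its threads, color the rest, choose a suitable color
  for \<open>v\<close>, and color the threads greedily from their far ends towards \<open>v\<close>. Greedy coloring
  never fails, except that it ignores the parity condition at \<open>v\<close>. That condition is void if
  \<open>v\<close> has odd degree; otherwise it is met by coloring one thread with two or three vertices
  last, after the color of \<open>v\<close> has been chosen to leave this thread some freedom. So a vertex
  has few long threads. Give each vertex \<open>v\<close> the charge \<open>9 deg v - 22\<close>, and let each
  vertex of degree at least 3 send charge 2 to every 2-vertex on its threads. All charges end up
  nonnegative, so the average degree is at least 22/9.
\<close>

section \<open>Parity of colors on neighbourhoods\<close>

text \<open>Parity is taken in the subgraph induced by the colored set \<open>S\<close>; values of
  \<open>f\<close> outside \<open>S\<close> do not count. The parity condition at \<open>u\<close>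
  says that this set is nonempty.\<close>

definition oddset :: "('a \<Rightarrow> 'a set) \<Rightarrow> 'a set \<Rightarrow> ('a \<Rightarrow> nat) \<Rightarrow> 'a \<Rightarrow> nat set" where
  "oddset N S f u = {k. odd (card {w \<in> N u \<inter> S. f w = k})}"

text \<open>The vertices in \<open>X\<close> are exempt from the parity condition.\<close>

definition good :: "('a \<Rightarrow> 'a set) \<Rightarrow> 'a set \<Rightarrow> ('a \<Rightarrow> nat) \<Rightarrow> 'a set \<Rightarrow> bool" where
  "good N S f X \<longleftrightarrow>
     (\<forall>u \<in> S. f u < 4) \<and> (\<forall>u \<in> S. \<forall>w \<in> N u \<inter> S. f u \<noteq> f w) \<and>
     (\<forall>u \<in> S - X. N u \<inter> S \<noteq> {} \<longrightarrow> oddset N S f u \<noteq> {})"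

lemma pick_color:
  assumes "finite B" "card B < 4"
  obtains k :: nat where "k < 4" "k \<notin> B"
proof -
  have "\<not> {..<4} \<subseteq> B"
    using assms card_mono[of B "{..<4::nat}"] by auto
  then show thesis using that by auto
qed

lemma pick_color3:
  obtains k :: nat where "k < 4" "k \<noteq> a" "k \<noteq> b" "k \<noteq> c"
proof -
  have "card {a, b, c} < 4" by (simp add: card_insert_if)
  then show thesis using pick_color[of "{a, b, c}"] that by auto
qed

lemma oddset_single:
  assumes "N u \<inter> S = {b}"
  shows "oddset N S f u = {f b}"
proof -
  have "{w \<in> N u \<inter> S. f w = k} = (if k = f b then {b} else {})" for k
    using assms by auto
  then show ?thesis by (auto simp: oddset_def)
qed

lemma oddset_pair:
  assumes "N u \<inter> S = {a, b}" "f a \<noteq> f b"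
  shows "oddset N S f u = {f a, f b}"
proof -
  have "{w \<in> N u \<inter> S. f w = k} = (if k = f a then {a} else if k = f b then {b} else {})" for k
    using assms by auto
  then show ?thesis by (auto simp: oddset_def)
qed

text \<open>One more neighbour of color \<open>k\<close> flips the parity of \<open>k\<close> alone,
  so the set becomes empty only if it was \<open>{k}\<close>.\<close>

lemma oddset_insert:
  assumes "finite (N u)" "x \<notin> S"
  shows "oddset N (insert x S) (f(x := k)) u =
    (if x \<in> N u then (if k \<in> oddset N S f u then oddset N S f u - {k} else insert k (oddset N S f u))
     else oddset N S f u)"
proof -
  have eq: "{w \<in> N u \<inter> insert x S. (f(x := k)) w = j} =
      (if x \<in> N u \<and> j = k then insert x {w \<in> N u \<inter> S. f w = j} else {w \<in> N u \<inter> S. f w = j})" for j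
    using assms(2) by auto
  have fin: "finite {w \<in> N u \<inter> S. f w = j}" for j
    using assms(1) by auto
  have "j \<in> oddset N (insert x S) (f(x := k)) u \<longleftrightarrow>
      (if x \<in> N u \<and> j = k then j \<notin> oddset N S f u else j \<in> oddset N S f u)" for j
    unfolding oddset_def mem_Collect_eq eq using fin[of j] assms(2) by (auto simp: card_insert_if)
  then show ?thesis
    by (intro set_eqI) (simp only: split: if_splits; blast)
qed

text \<open>An odd number is not a sum of even color counts. This is why vertices of odd degree
  carry no parity constraint.\<close>

lemma oddset_odd_card:
  assumes "finite (N u)" "\<forall>w \<in> S. f w < 4" "odd (card (N u \<inter> S))"
  shows "oddset N S f u \<noteq> {}"
proof
  assume "oddset N S f u = {}"
  then have ev: "even (card {w \<in> N u \<inter> S. f w = k})" for k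
    by (auto simp: oddset_def)
  have "N u \<inter> S = (\<Union>k\<in>{..<4}. {w \<in> N u \<inter> S. f w = k})"
    using assms(2) by auto
  then have "card (N u \<inter> S) = card (\<Union>k\<in>{..<4}. {w \<in> N u \<inter> S. f w = k})"
    by (rule arg_cong)
  also have "\<dots> = (\<Sum>k<4. card {w \<in> N u \<inter> S. f w = k})"
    by (rule card_UN_disjoint) (use assms(1) in auto)
  finally have "even (card (N u \<inter> S))"
    by (simp only:) (rule dvd_sum, rule ev)
  with assms(3) show False by simp
qed

lemma good_mono: "good N S f X \<Longrightarrow> X \<subseteq> Y \<Longrightarrow> good N S f Y"
  unfolding good_def by blast

lemma good_lt: "good N S f X \<Longrightarrow> u \<in> S \<Longrightarrow> f u < 4"
  unfolding good_def by blast

lemma good_drop: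
  assumes "good N S f (insert v X)" "oddset N S f v \<noteq> {}"
  shows "good N S f X"
  using assms unfolding good_def by blast

section \<open>Extending colorings along threads\<close>

locale sgraph =
  fixes V :: "'a set" and N :: "'a \<Rightarrow> 'a set"
  assumes finV: "finite V"
    and N_V: "u \<in> N v \<Longrightarrow> u \<in> V"
    and N_sym: "u \<in> N v \<Longrightarrow> v \<in> N u"
    and N_irrefl: "v \<notin> N v"
begin

lemma finN: "finite (N u)"
  using finV N_V by (meson finite_subset subsetI)

lemmas oddset_ins = oddset_insert[of N, OF finN]

text \<open>An old neighbour \<open>u\<close> loses its parity condition only if its odd set is
  \<open>{k}\<close>. The condition at \<open>x\<close> does not see the color of \<open>x\<close>,
  so \<open>self\<close> can speak of \<open>f\<close>.\<close>

lemma good_insert: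
  assumes g: "good N S f X" and x: "x \<notin> S" and k: "k < 4"
    and nb: "\<And>u. u \<in> N x \<inter> S \<Longrightarrow> f u \<noteq> k \<and> (u \<notin> X \<longrightarrow> oddset N S f u \<noteq> {k})"
    and self: "x \<in> X \<or> N x \<inter> S = {} \<or> oddset N S f x \<noteq> {}"
  shows "good N (insert x S) (f(x := k)) X"
proof -
  let ?f = "f(x := k)" and ?S = "insert x S"
  have lt: "\<forall>u\<in>?S. ?f u < 4"
    using g k by (auto simp: good_def)
  have proper: "?f u \<noteq> ?f w" if "u \<in> ?S" "w \<in> N u \<inter> ?S" for u w
    using that nb[of u] nb[of w] g N_irrefl[of x] N_sym[of w u] x
    unfolding good_def by (cases "u = x"; cases "w = x") auto
  have "oddset N ?S ?f u \<noteq> {}" if u: "u \<in> ?S - X" "N u \<inter> ?S \<noteq> {}" for u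
  proof (cases "u = x")
    case True
    then have "oddset N ?S ?f u = oddset N S f x"
      using oddset_ins[OF x, of f k u] N_irrefl by simp
    moreover have "N x \<inter> S \<noteq> {}" using u True N_irrefl by auto
    ultimately show ?thesis using self u True by auto
  next
    case False
    then have uS: "u \<in> S" using u by auto
    show ?thesis
    proof (cases "x \<in> N u")
      case True
      then have "u \<in> N x \<inter> S" using uS N_sym by auto
      then have "oddset N S f u \<noteq> {k}" using nb u by auto
      then show ?thesis
        using oddset_ins[OF x, of f k u] True by auto
    next
      case False
      then have "N u \<inter> S \<noteq> {}" using u by auto
      then have "oddset N S f u \<noteq> {}" using g uS u by (auto simp: good_def)
      then show ?thesis
        using oddset_ins[OF x, of f k u] False by auto
    qed
  qed
  then show ?thesis
    using lt proper unfolding good_def by blast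
qed

lemma add_leaf:
  assumes "good N S f X" "x \<notin> S" "N x \<inter> S = {b}" "k < 4" "k \<noteq> f b"
    "b \<notin> X \<Longrightarrow> oddset N S f b \<noteq> {k}"
  shows "good N (insert x S) (f(x := k)) X"
  by (rule good_insert) (use assms oddset_single[of N x S b f] in auto)

lemma add_link:
  assumes "good N S f X" "x \<notin> S" "N x \<inter> S = {a, b}" "k < 4" "k \<noteq> f a" "k \<noteq> f b" "f a \<noteq> f b"
    "a \<notin> X \<Longrightarrow> oddset N S f a \<noteq> {k}" "b \<notin> X \<Longrightarrow> oddset N S f b \<noteq> {k}"
  shows "good N (insert x S) (f(x := k)) X"
  by (rule good_insert) (use assms oddset_pair[of N x S a b f] in auto)

text \<open>
  A new neighbour of \<open>b\<close> spoils the parity condition at \<open>b\<close> only if it gets the single odd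
  color of \<open>b\<close>. So it suffices to avoid the element of the odd set given by \<open>the_elem\<close>, which is
  an arbitrary color when that set is not a singleton.
\<close>

lemma thread1:
  assumes g: "good N S f X" and v: "v \<in> X" "v \<in> S" and b: "b \<in> S"
    and x: "x \<notin> S" "N x = {v, b}" and ne: "f v \<noteq> f b"
  shows "\<exists>f'. good N (insert x S) f' X \<and> (\<forall>u\<in>S. f' u = f u)"
proof -
  obtain k where k: "k < 4" "k \<noteq> f v" "k \<noteq> f b" "k \<noteq> the_elem (oddset N S f b)"
    using pick_color3 .
  have "good N (insert x S) (f(x := k)) X"
    by (rule add_link[OF g x(1), of v b]) (use k v b x ne in auto)
  then show ?thesis using x by (intro exI[of _ "f(x := k)"]) auto
qed

text \<open>\<open>y\<close> is colored first and avoids \<open>f v\<close>, so that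
  \<open>x\<close> sees two colors; then \<open>x\<close> avoids \<open>f b\<close>, so that
  \<open>y\<close> does. Hence, unlike in \<open>thread1\<close>, the color of \<open>v\<close> is
  unrestricted.\<close>

lemma thread2:
  assumes g: "good N S f X" and v: "v \<in> X" "v \<in> S" and b: "b \<in> S"
    and x: "x \<notin> S" "y \<notin> S" "x \<noteq> y" "N x = {v, y}" "N y = {x, b}"
  shows "\<exists>f'. good N (insert x (insert y S)) f' X \<and> (\<forall>u\<in>S. f' u = f u)"
proof -
  obtain ky where ky: "ky < 4" "ky \<noteq> f v" "ky \<noteq> f b" "ky \<noteq> the_elem (oddset N S f b)"
    using pick_color3 .
  let ?f = "f(y := ky)"
  have g1: "good N (insert y S) ?f X"
    by (rule add_leaf[OF g, of y b]) (use ky v b x in auto)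
  obtain kx where kx: "kx < 4" "kx \<noteq> f v" "kx \<noteq> ky" "kx \<noteq> f b"
    using pick_color3 .
  have oy: "oddset N (insert y S) ?f y = {?f b}"
    by (rule oddset_single) (use b x N_irrefl in auto)
  have "good N (insert x (insert y S)) (?f(x := kx)) X"
    by (rule add_link[OF g1, of x v y]) (use kx ky v b x oy in auto)
  then show ?thesis using x by (intro exI[of _ "?f(x := kx)"]) auto
qed

text \<open>Once \<open>z\<close> is colored, it serves as the far end of the thread
  \<open>x\<close>, \<open>y\<close>.\<close>

lemma thread3:
  assumes g: "good N S f X" and v: "v \<in> X" "v \<in> S" and b: "b \<in> S"
    and x: "x \<notin> S" "y \<notin> S" "z \<notin> S" "x \<noteq> y" "y \<noteq> z" "x \<noteq> z"
      "N x = {v, y}" "N y = {x, z}" "N z = {y, b}"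
  shows "\<exists>f'. good N (insert x (insert y (insert z S))) f' X \<and> (\<forall>u\<in>S. f' u = f u)"
proof -
  obtain kz where kz: "kz < 4" "kz \<noteq> f b" "kz \<noteq> the_elem (oddset N S f b)"
    using pick_color3 .
  let ?f = "f(z := kz)"
  have g1: "good N (insert z S) ?f X"
    by (rule add_leaf[OF g, of z b]) (use kz v b x in auto)
  have "\<exists>f'. good N (insert x (insert y (insert z S))) f' X \<and> (\<forall>u\<in>insert z S. f' u = ?f u)"
    by (rule thread2[OF g1, of v z x y]) (use v b x in auto)
  then show ?thesis using x by auto
qed

text \<open>
  Either alternative in the last assumption leaves enough freedom for the color of \<open>x\<close> to avoid
  the odd color of \<open>v\<close> as well.
\<close>

lemma finish_thread:
  assumes g: "good N S f {v}" and v: "v \<in> S" and b: "b \<in> S" "v \<noteq> b"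
    and x: "x \<notin> S" "y \<notin> S" "x \<noteq> y" "N x = {v, y}" "N y = {x, b}"
    and c: "f b = f v \<or> oddset N S f b = {f v}"
  shows "\<exists>f'. good N (insert x (insert y S)) f' {}"
proof -
  let ?o = "the_elem (oddset N S f v)"
  \<comment> \<open>\<open>kx\<close> has the four forbidden colors \<open>f v\<close>,
    \<open>f b\<close>, \<open>ky\<close>, \<open>?o\<close>. If \<open>f b = f v\<close>, only
    three remain; otherwise \<open>f v\<close> is also the odd color of \<open>b\<close>, so
    \<open>ky\<close> has a color to spare and can be chosen after \<open>kx\<close>.\<close>
  obtain kx ky where k: "kx < 4" "ky < 4" "ky \<noteq> f b" "oddset N S f b \<noteq> {ky}" "kx \<noteq> f v"
    "ky \<noteq> f v" "kx \<noteq> f b" "kx \<noteq> ky" "kx \<noteq> ?o"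
  proof (cases "f b = f v")
    case True
    obtain ky where ky: "ky < 4" "ky \<noteq> f v" "ky \<noteq> the_elem (oddset N S f b)"
      using pick_color3 .
    obtain kx where kx: "kx < 4" "kx \<noteq> f v" "kx \<noteq> ky" "kx \<noteq> ?o"
      using pick_color3 .
    have "oddset N S f b \<noteq> {ky}" using ky(3) by force
    then show thesis by (intro that[of kx ky]) (simp_all add: True kx ky)
  next
    case False
    then have c: "oddset N S f b = {f v}" using c by simp
    obtain kx where kx: "kx < 4" "kx \<noteq> f v" "kx \<noteq> f b" "kx \<noteq> ?o"
      using pick_color3 .
    obtain ky where ky: "ky < 4" "ky \<noteq> f v" "ky \<noteq> f b" "ky \<noteq> kx"
      using pick_color3 .
    show thesis by (intro that[of kx ky]) (use kx ky c in simp_all)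
  qed
  let ?f = "f(y := ky)" and ?S = "insert y S"
  have g1: "good N ?S ?f {v}"
    by (rule add_leaf[OF g, of y b]) (use k v b x in auto)
  have oy: "oddset N ?S ?f y = {?f b}"
    by (rule oddset_single) (use b x N_irrefl in auto)
  have g2: "good N (insert x ?S) (?f(x := kx)) {v}"
    by (rule add_link[OF g1, of x v y]) (use k v b x oy in auto)
  have "y \<notin> N v" using N_sym[of y v] x v b by auto
  then have "oddset N ?S ?f v = oddset N S f v"
    using oddset_ins[OF x(2), of f ky v] by simp
  moreover have "oddset N S f v \<noteq> {kx}" using k(9) by force
  ultimately have "oddset N (insert x ?S) (?f(x := kx)) v \<noteq> {}"
    using oddset_ins[of x ?S ?f kx v] x N_sym[of v x] by auto
  then show ?thesis using good_drop[of N _ _ v "{}"] g2 by blast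
qed

text \<open>The extension step is assumed for every larger \<open>S'\<close> and every
  \<open>f'\<close> agreeing with \<open>f\<close> on \<open>S\<close>, since other sets
  \<open>I y\<close> may be colored before its turn comes.\<close>

lemma fill:
  assumes "finite T"
    and "good N S f X" "\<And>x y. x \<in> T \<Longrightarrow> y \<in> T \<Longrightarrow> x \<noteq> y \<Longrightarrow> I x \<inter> I y = {}"
    and "\<And>x. x \<in> T \<Longrightarrow> I x \<inter> S = {}"
    and "\<And>x S' f'. x \<in> T \<Longrightarrow> S \<subseteq> S' \<Longrightarrow> I x \<inter> S' = {} \<Longrightarrow> good N S' f' X \<Longrightarrow>
      \<forall>u\<in>S. f' u = f u \<Longrightarrow> \<exists>f''. good N (S' \<union> I x) f'' X \<and> (\<forall>u\<in>S'. f'' u = f' u)"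
  shows "\<exists>f'. good N (S \<union> \<Union>(I ` T)) f' X \<and> (\<forall>u\<in>S. f' u = f u)"
  using assms(1,3,4,5)
proof (induction T)
  case empty
  then show ?case using assms(2) by auto
next
  case (insert x T)
  have "\<exists>f'. good N (S \<union> \<Union>(I ` T)) f' X \<and> (\<forall>u\<in>S. f' u = f u)"
    by (rule insert.IH) (use insert.prems in auto)
  then obtain f' where f': "good N (S \<union> \<Union>(I ` T)) f' X" "\<forall>u\<in>S. f' u = f u" by blast
  have "I x \<inter> (S \<union> \<Union>(I ` T)) = {}"
  proof -
    have "I x \<inter> I y = {}" if "y \<in> T" for y
      using insert.prems(1)[of x y] insert.hyps that by auto
    then show ?thesis using insert.prems(2)[of x] by auto
  qed
  then obtain f'' where "good N (S \<union> \<Union>(I ` T) \<union> I x) f'' X" "\<forall>u\<in>S \<union> \<Union>(I ` T). f'' u = f' u"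
    using insert.prems(3)[of x "S \<union> \<Union>(I ` T)" f'] f' by auto
  then show ?case using f'(2)
    by (intro exI[of _ f'']) (auto simp: Un_ac)
qed

end

section \<open>Reducible configurations\<close>

text \<open>A vertex-minimal counterexample; the aim is the edge bound \<open>dense\<close>, which
  contradicts sparsity. \<open>C5_free\<close> lists five edges and five missing chords.\<close>

locale critical = sgraph +
  assumes smaller: "S \<subset> V \<Longrightarrow> \<exists>f. good N S f {}"
    and not_good: "\<not> good N V f {}"
    and C5_free: "\<lbrakk>distinct [a, b, c, d, e]; b \<in> N a; c \<in> N b; d \<in> N c; e \<in> N d; a \<in> N e;
      c \<notin> N a; d \<notin> N a; d \<notin> N b; e \<notin> N b; e \<notin> N c\<rbrakk> \<Longrightarrow> False"
begin

definition D2 where "D2 = {x \<in> V. card (N x) = 2}"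

text \<open>One step along a thread: for a 2-vertex \<open>x\<close> entered from its neighbour
  \<open>p\<close>, the vertex where the walk leaves.\<close>

definition nx where "nx p x = (SOME u. u \<in> N x \<and> u \<noteq> p)"

lemma nx_ends:
  assumes "x \<in> D2" "p \<in> N x"
  shows "N x = {p, nx p x}" "nx p x \<noteq> p"
proof -
  obtain s t where st: "N x = {s, t}" "s \<noteq> t"
    using assms(1) by (auto simp: D2_def card_2_iff)
  then have "\<exists>u. u \<in> N x \<and> u \<noteq> p" by auto
  then have "nx p x \<in> N x \<and> nx p x \<noteq> p"
    unfolding nx_def by (rule someI_ex)
  then show "N x = {p, nx p x}" "nx p x \<noteq> p"
    using st assms(2) by auto
qed

lemma nx_eq: "N x = {p, q} \<Longrightarrow> p \<noteq> q \<Longrightarrow> nx p x = q"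
  unfolding nx_def by (rule some_equality) auto

lemma N_ne: "u \<in> N v \<Longrightarrow> u \<noteq> v"
  using N_irrefl by auto

section \<open>Small degrees, short cycles and long threads of 2-vertices\<close>

lemma no_small:
  assumes "v \<in> V" shows "card (N v) \<ge> 2"
proof (rule ccontr)
  assume "\<not> ?thesis"
  then consider "card (N v) = 0" | "card (N v) = 1" by linarith
  then show False
  proof cases
    case 1
    then have N: "N v = {}" using finN by auto
    obtain f where f: "good N (V - {v}) f {}" using smaller[of "V - {v}"] assms by auto
    have "good N (insert v (V - {v})) (f(v := 0)) {}"
      by (rule good_insert[OF f]) (use N in auto)
    then show False using not_good assms by (simp add: insert_absorb)
  next
    case 2
    then obtain u where u: "N v = {u}" by (auto simp: card_1_singleton_iff)
    obtain f where f: "good N (V - {v}) f {}" using smaller[of "V - {v}"] assms by auto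
    have uV: "u \<in> V" "u \<noteq> v" using u N_V[of u v] N_irrefl[of v] by auto
    obtain k where k: "k < 4" "k \<noteq> f u" "k \<noteq> the_elem (oddset N (V - {v}) f u)"
      using pick_color3 .
    have "good N (insert v (V - {v})) (f(v := k)) {}"
      by (rule add_leaf[OF f, of v u]) (use u uV k in auto)
    then show False using not_good assms by (simp add: insert_absorb)
  qed
qed

text \<open>\<open>x\<close> and \<open>y\<close> are deleted and recolored. Both are neighbours of
  \<open>v\<close>, so \<open>ky\<close> avoids the odd color of \<open>v\<close> computed after
  \<open>x\<close> has been colored.\<close>

lemma no_triangle:
  assumes "N x = {v, y}" "N y = {x, v}"
  shows False
proof -
  have d: "x \<noteq> y" "v \<noteq> x" "v \<noteq> y" and V: "v \<in> V" "x \<in> V" "y \<in> V"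
    using assms N_irrefl[of x] N_irrefl[of y] N_V[of v x] N_V[of x y] N_V[of y x] by auto
  define S where "S = V - {x, y}"
  obtain f where f: "good N S f {}" using smaller[of S] V by (auto simp: S_def)
  have S: "x \<notin> S" "y \<notin> S" "v \<in> S" "insert y (insert x S) = V" using V d by (auto simp: S_def)
  obtain kx where kx: "kx < 4" "kx \<noteq> f v" "kx \<noteq> the_elem (oddset N S f v)"
    using pick_color3 .
  let ?f = "f(x := kx)"
  have g1: "good N (insert x S) ?f {}"
    by (rule add_leaf[OF f, of x v]) (use kx S assms in auto)
  obtain ky where ky: "ky < 4" "ky \<noteq> f v" "ky \<noteq> kx" "ky \<noteq> the_elem (oddset N (insert x S) ?f v)"
    using pick_color3 .
  have ox: "oddset N (insert x S) ?f x = {?f v}"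
    by (rule oddset_single) (use assms S d in auto)
  have "good N (insert y (insert x S)) (?f(y := ky)) {}"
    by (rule add_link[OF g1, of y x v]) (use kx ky S assms d ox in auto)
  then show False using not_good S by simp
qed

text \<open>\<open>x\<close> and \<open>z\<close> get distinct colors as leaves at \<open>v\<close>;
  then \<open>y\<close>, colored last, has the forbidden colors \<open>kx\<close>, \<open>kz\<close>
  and, for the parity at \<open>x\<close> and \<open>z\<close>, \<open>f v\<close>.\<close>

lemma no_square:
  assumes "N x = {v, y}" "N y = {x, z}" "N z = {y, v}" "x \<noteq> z" "v \<noteq> y"
  shows False
proof -
  have d: "x \<noteq> y" "v \<noteq> x" "z \<noteq> y" "v \<noteq> z" and V: "v \<in> V" "x \<in> V" "y \<in> V" "z \<in> V"
    using assms N_irrefl[of x] N_irrefl[of y] N_irrefl[of z]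
      N_V[of v x] N_V[of x y] N_V[of y x] N_V[of z y] by auto
  define S where "S = V - {x, y, z}"
  obtain f where f: "good N S f {}" using smaller[of S] V by (auto simp: S_def)
  have S: "x \<notin> S" "y \<notin> S" "z \<notin> S" "v \<in> S" "insert y (insert z (insert x S)) = V"
    using V d assms by (auto simp: S_def)
  obtain kx where kx: "kx < 4" "kx \<noteq> f v" "kx \<noteq> the_elem (oddset N S f v)"
    using pick_color3 .
  let ?f = "f(x := kx)"
  have g1: "good N (insert x S) ?f {}"
    by (rule add_leaf[OF f, of x v]) (use kx S assms in auto)
  obtain kz where kz: "kz < 4" "kz \<noteq> f v" "kz \<noteq> kx" "kz \<noteq> the_elem (oddset N (insert x S) ?f v)"
    using pick_color3 .
  let ?g = "?f(z := kz)"
  have g2: "good N (insert z (insert x S)) ?g {}"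
    by (rule add_leaf[OF g1, of z v]) (use kz S assms d in auto)
  obtain ky where ky: "ky < 4" "ky \<noteq> f v" "ky \<noteq> kx" "ky \<noteq> kz"
    using pick_color3 .
  have ox: "oddset N (insert z (insert x S)) ?g x = {?g v}"
    by (rule oddset_single) (use assms S d in auto)
  have oz: "oddset N (insert z (insert x S)) ?g z = {?g v}"
    by (rule oddset_single) (use assms S d in auto)
  have "good N (insert y (insert z (insert x S))) (?g(y := ky)) {}"
    by (rule add_link[OF g2, of y x z]) (use kx ky kz S assms d ox oz in auto)
  then show False using not_good S by simp
qed

text \<open>The one place where \<open>C5_free\<close> enters: every chord of the cycle
  \<open>v x y z w\<close> would end in one of the 2-vertices \<open>x\<close>, \<open>y\<close>,
  \<open>z\<close>.\<close>

lemma no_pentagon: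
  assumes "N x = {v, y}" "N y = {x, z}" "N z = {y, w}" "v \<in> N w"
    "x \<noteq> z" "v \<noteq> y" "w \<noteq> y"
  shows False
proof -
  have d: "x \<noteq> y" "v \<noteq> x" "z \<noteq> y" "w \<noteq> z" "v \<noteq> w"
    using assms N_irrefl[of x] N_irrefl[of y] N_irrefl[of z] N_irrefl[of w] by auto
  have "v \<noteq> z" using assms no_triangle d N_sym[of v x] by auto
  moreover have "w \<noteq> x" using calculation assms d N_sym[of z w] N_sym[of w z] by auto
  ultimately have "distinct [v, x, y, z, w]" using d assms by auto
  moreover have "y \<notin> N v" "z \<notin> N v" using N_sym[of y v] N_sym[of z v] assms d \<open>v \<noteq> z\<close> by auto
  ultimately show False
    using assms C5_free[of v x y z w] N_sym[of v x] N_sym[of z w] by auto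
qed

lemma no_thread4:
  assumes N: "N x = {a, y}" "N y = {x, z}" "N z = {y, w}" "N w = {z, b}"
    and ne: "x \<noteq> z" "a \<noteq> y" "w \<noteq> y" "b \<noteq> z"
  shows False
proof -
  have d: "x \<noteq> y" "a \<noteq> x" "z \<noteq> y" "w \<noteq> z" "b \<noteq> w"
    using N N_irrefl[of x] N_irrefl[of y] N_irrefl[of z] N_irrefl[of w] by auto
  have V: "a \<in> V" "x \<in> V" "y \<in> V" "z \<in> V" "w \<in> V" "b \<in> V"
    using N N_V[of a x] N_V[of x y] N_V[of y x] N_V[of z y] N_V[of w z] N_V[of b w] by auto
  \<comment> \<open>Coincidences among the six vertices would close a short cycle;
    \<open>a = b\<close> would close an induced 5-cycle.\<close>
  have az: "a \<noteq> z" using N no_triangle[of x z y] by auto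
  have xw: "x \<noteq> w" using N ne az d by (auto simp: doubleton_eq_iff)
  have yb: "b \<noteq> y" using N N_sym[of b w] xw d ne by auto
  have aw: "a \<noteq> w" using no_square[of x w y z] N ne d by auto
  have xb: "x \<noteq> b" using N N_sym[of b w] aw d ne by auto
  have ab: "a \<noteq> b" using no_pentagon[of x a y z w] N ne by auto
  define S where "S = V - {x, y, z, w}"
  obtain f where f: "good N S f {}" using smaller[of S] V by (auto simp: S_def)
  have S: "x \<notin> S" "y \<notin> S" "z \<notin> S" "w \<notin> S" "a \<in> S" "b \<in> S"
    "insert z (insert y (insert w (insert x S))) = V"
    using V d az aw yb xb ne by (auto simp: S_def)
  let ?oa = "the_elem (oddset N S f a)" and ?ob = "the_elem (oddset N S f b)"
  \<comment> \<open>\<open>z\<close> is colored last and must avoid \<open>kx\<close>,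
    \<open>ky\<close>, \<open>kw\<close>, \<open>f b\<close>, so one coincidence is needed. If
    \<open>f b\<close> is \<open>f a\<close> or \<open>?oa\<close>, a color avoiding
    \<open>f a\<close>, \<open>?oa\<close>, \<open>?ob\<close> suits both \<open>x\<close> and
    \<open>w\<close>; otherwise \<open>f b\<close> itself suits \<open>x\<close>.\<close>
  obtain kx kw ky kz where k: "kx < 4" "kw < 4" "ky < 4" "kz < 4" "kx \<noteq> f a" "kx \<noteq> ?oa"
    "kw \<noteq> f b" "kw \<noteq> ?ob" "ky \<noteq> kx" "ky \<noteq> f a" "ky \<noteq> kw" "kz \<noteq> ky" "kz \<noteq> kw" "kz \<noteq> kx" "kz \<noteq> f b"
  proof (cases "f b = f a \<or> f b = ?oa")
    case True
    obtain k where k: "k < 4" "k \<noteq> f a" "k \<noteq> ?oa" "k \<noteq> ?ob"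
      using pick_color3 .
    obtain ky where ky: "ky < 4" "ky \<noteq> k" "ky \<noteq> f a"
      using pick_color3 .
    obtain kz where "kz < 4" "kz \<noteq> k" "kz \<noteq> ky" "kz \<noteq> f b"
      using pick_color3 .
    then show thesis using k ky True by (intro that[of k k ky kz]) auto
  next
    case False
    obtain kw where kw: "kw < 4" "kw \<noteq> f b" "kw \<noteq> ?ob"
      using pick_color3 .
    obtain ky where ky: "ky < 4" "ky \<noteq> f b" "ky \<noteq> f a" "ky \<noteq> kw"
      using pick_color3 .
    obtain kz where kz: "kz < 4" "kz \<noteq> kw" "kz \<noteq> ky" "kz \<noteq> f b"
      using pick_color3 .
    have "f b < 4" using good_lt[OF f] S by auto
    then show thesis using kw ky kz False by (intro that[of "f b" kw ky kz]) auto
  qed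
  let ?f = "f(x := kx)" and ?S = "insert x S"
  let ?g = "?f(w := kw)" and ?T = "insert w ?S"
  let ?h = "?g(y := ky)" and ?U = "insert y ?T"
  have g1: "good N ?S ?f {}"
    by (rule add_leaf[OF f, of x a]) (use k S N in auto)
  have "x \<notin> N b" using N_sym[of x b] N ab yb by auto
  then have ob: "oddset N ?S ?f b = oddset N S f b"
    using oddset_ins[OF S(1), of f kx b] by simp
  have g2: "good N ?T ?g {}"
    by (rule add_leaf[OF g1, of w b]) (use k S N ob xb xw ne in auto)
  have ox: "oddset N ?T ?g x = {?g a}"
    by (rule oddset_single) (use N S d ne aw in auto)
  have g3: "good N ?U ?h {}"
    by (rule add_leaf[OF g2, of y x]) (use k S N ox xw ne d aw in auto)
  have oy: "oddset N ?U ?h y = {?h x}"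
    by (rule oddset_single) (use N S d ne xw in auto)
  have ow: "oddset N ?U ?h w = {?h b}"
    by (rule oddset_single) (use N S d ne xw yb xb in auto)
  have "good N (insert z ?U) (?h(z := kz)) {}"
    by (rule add_link[OF g3, of z y w]) (use k S N oy ow xw ne d yb xb in auto)
  then show False using not_good S by simp
qed

text \<open>Only \<open>x\<close> and \<open>y\<close> are recolored, by \<open>thread2\<close> with
  \<open>v\<close> exempt; the condition at \<open>v\<close> then holds by odd degree.\<close>

lemma odd_no_thread2:
  assumes v: "odd (card (N v))" and N: "N x = {v, y}" "N y = {x, b}" "v \<noteq> y" "x \<noteq> b"
  shows False
proof -
  have d: "x \<noteq> y" "v \<noteq> x" "b \<noteq> y" and V: "v \<in> V" "x \<in> V" "y \<in> V" "b \<in> V"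
    using N N_irrefl[of x] N_irrefl[of y] N_V[of v x] N_V[of x y] N_V[of y x] N_V[of b y] by auto
  have "v \<noteq> b" using no_triangle[of x v y] N by auto
  define S where "S = V - {x, y}"
  have S: "x \<notin> S" "y \<notin> S" "v \<in> S" "b \<in> S" "insert x (insert y S) = V"
    using V d N by (auto simp: S_def)
  obtain f where f: "good N S f {}" using smaller[of S] V by (auto simp: S_def)
  have "good N S f {v}" by (rule good_mono[OF f]) auto
  then obtain f' where f': "good N V f' {v}"
    using thread2[of S f "{v}" v b x y] S N d by auto
  have "N v \<inter> V = N v" using N_V by auto
  then have "oddset N V f' v \<noteq> {}"
    using oddset_odd_card[of N v V f'] finN good_lt[OF f'] v by auto
  then show False using good_drop[OF f'] not_good by auto
qed


text \<open>
  \<open>A1 v\<close>, \<open>A2 v\<close>, \<open>A3 v\<close> are the neighbours of \<open>v\<close> at which a thread with at least one, two,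
  three vertices of degree 2 starts. The interior of the thread through \<open>x\<close> is \<open>thread_of v x\<close>
  and its far end is \<open>endp v x\<close>; no thread is longer by \<open>no_thread4\<close>.
\<close>

definition A1 where "A1 v = N v \<inter> D2"
definition A2 where "A2 v = {x \<in> A1 v. nx v x \<in> D2}"
definition A3 where "A3 v = {x \<in> A2 v. nx x (nx v x) \<in> D2}"

definition thread_of where
  "thread_of v x = {x} \<union> (if x \<in> A2 v then {nx v x} else {}) \<union>
     (if x \<in> A3 v then {nx x (nx v x)} else {})"

definition endp where
  "endp v x = (if x \<in> A3 v then nx (nx v x) (nx x (nx v x))
     else if x \<in> A2 v then nx x (nx v x) else nx v x)"

lemma A_sub: "A3 v \<subseteq> A2 v" "A2 v \<subseteq> A1 v" "A1 v \<subseteq> D2" "A1 v \<subseteq> N v" "finite (A1 v)"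
  using finN by (auto simp: A1_def A2_def A3_def)

lemma A1D:
  assumes "x \<in> A1 v"
  shows "N x = {v, nx v x}" "nx v x \<noteq> v" "x \<in> D2" "x \<in> N v" "nx v x \<noteq> x" "x \<noteq> v"
proof -
  show xD: "x \<in> D2" and xN: "x \<in> N v" using assms by (auto simp: A1_def)
  show Nx: "N x = {v, nx v x}" and "nx v x \<noteq> v" using nx_ends[OF xD N_sym[OF xN]] .
  show "nx v x \<noteq> x" "x \<noteq> v" using N_ne[of "nx v x" x] N_ne[OF xN] Nx by blast+
qed

lemma A2D:
  assumes v: "v \<notin> D2" and "x \<in> A2 v"
  shows "N (nx v x) = {x, nx x (nx v x)}" "nx x (nx v x) \<noteq> x" "nx v x \<in> D2" "nx v x \<notin> N v"
    "nx x (nx v x) \<noteq> v" "nx x (nx v x) \<noteq> nx v x"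
proof -
  let ?y = "nx v x"
  have x1: "x \<in> A1 v" using assms A_sub by auto
  note x = A1D[OF x1]
  show y: "?y \<in> D2" using assms by (auto simp: A2_def)
  have "x \<in> N ?y" using N_sym[of ?y x] x by auto
  then show Ny: "N ?y = {x, nx x ?y}" "nx x ?y \<noteq> x" using nx_ends[OF y] by auto
  show nv: "nx x ?y \<noteq> v" using no_triangle[of x v ?y] Ny x by auto
  show "?y \<notin> N v" using N_sym[of ?y v] Ny x nv by auto
  show "nx x ?y \<noteq> ?y" using N_ne[of "nx x ?y" ?y] Ny by blast
qed

text \<open>A return to \<open>v\<close> is excluded by \<open>no_square\<close>, a fourth 2-vertex
  by \<open>no_thread4\<close>.\<close>

lemma A3D:
  assumes v: "v \<notin> D2" and "x \<in> A3 v"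
  defines "y \<equiv> nx v x" and "z \<equiv> nx x (nx v x)"
  shows "N z = {y, nx y z}" "nx y z \<noteq> y" "z \<in> D2" "z \<notin> N v" "nx y z \<noteq> v" "nx y z \<notin> D2"
    "nx y z \<noteq> z"
proof -
  have x2: "x \<in> A2 v" and x1: "x \<in> A1 v" using assms A_sub by auto
  note x = A1D[OF x1, folded y_def] A2D[OF v x2, folded y_def z_def]
  show z: "z \<in> D2" using assms by (auto simp: A3_def)
  have "z \<noteq> y" using x by (auto simp: z_def)
  have "y \<in> N z" using N_sym[of z y] x by (auto simp: y_def z_def)
  then show Nz: "N z = {y, nx y z}" "nx y z \<noteq> y" using nx_ends[OF z] by auto
  show nv: "nx y z \<noteq> v" using no_square[of x v y z] Nz x by (auto simp: z_def y_def)
  show "z \<notin> N v" using N_sym[of z v] Nz x nv by auto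
  show "nx y z \<noteq> z" using N_ne[of "nx y z" z] Nz by blast
  show "nx y z \<notin> D2"
  proof
    assume w: "nx y z \<in> D2"
    have "z \<in> N (nx y z)" using N_sym[of "nx y z" z] Nz by auto
    then have "N (nx y z) = {z, nx z (nx y z)}" "nx z (nx y z) \<noteq> z" using nx_ends[OF w] by auto
    then show False
      using no_thread4[of x v y z "nx y z"] Nz x by (auto simp: z_def y_def)
  qed
qed

lemma endp_props:
  assumes "v \<notin> D2" "x \<in> A1 v"
  shows "endp v x \<notin> D2" "endp v x \<in> V" "endp v x \<noteq> v"
proof -
  note x1 = A1D[OF assms(2)]
  have "endp v x \<notin> D2 \<and> endp v x \<in> V \<and> endp v x \<noteq> v"
  proof (cases "x \<in> A3 v")
    case True
    then show ?thesis using A3D[OF assms(1) True] N_V[of "endp v x" "nx x (nx v x)"]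
      by (auto simp: endp_def)
  next
    case not3: False
    show ?thesis
    proof (cases "x \<in> A2 v")
      case True
      then show ?thesis using not3 A2D[OF assms(1) True] N_V[of "endp v x" "nx v x"]
        by (auto simp: endp_def A3_def)
    next
      case False
      then show ?thesis using not3 x1 N_V[of "endp v x" x] assms(2)
        by (auto simp: endp_def A2_def)
    qed
  qed
  then show "endp v x \<notin> D2" "endp v x \<in> V" "endp v x \<noteq> v" by auto
qed

lemma thread_of_D2: "v \<notin> D2 \<Longrightarrow> x \<in> A1 v \<Longrightarrow> thread_of v x \<subseteq> D2"
  using A1D(3) by (auto simp: thread_of_def A2_def A3_def)

text \<open>Threads sharing a vertex would join to one path of 2-vertices from \<open>v\<close> back
  to \<open>v\<close>. But only the first vertex of a thread is adjacent to \<open>v\<close>, and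
  the vertex after a third one is not in \<open>D2\<close>.\<close>

lemma thread_of_disjoint:
  assumes v: "v \<notin> D2" and x: "x \<in> A1 v" "x' \<in> A1 v" "x \<noteq> x'"
  shows "thread_of v x \<inter> thread_of v x' = {}"
proof -
  have yy: "nx v s \<noteq> nx v t" if "s \<in> A2 v" "t \<in> A2 v" "s \<noteq> t" for s t
  proof
    assume eq: "nx v s = nx v t"
    then have t: "t = nx s (nx v s)"
      using A2D(1)[OF v that(1)] A2D(1)[OF v that(2)] that(3) by auto
    then have "s \<in> A3 v" using that A_sub by (auto simp: A3_def)
    then have "t \<notin> N v" using A3D(4)[OF v] t by simp
    then show False using that(2) A_sub by blast
  qed
  have zz: "nx s (nx v s) \<noteq> nx t (nx v t)" if "s \<in> A3 v" "t \<in> A3 v" "s \<noteq> t" for s t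
  proof
    assume eq: "nx s (nx v s) = nx t (nx v t)"
    have ne: "nx v s \<noteq> nx v t" using yy that A_sub by blast
    have "nx v t \<in> N (nx s (nx v s))" using A3D(1)[OF v that(2)] eq by auto
    then have "nx v t = nx (nx v s) (nx s (nx v s))"
      using A3D(1)[OF v that(1)] ne by auto
    moreover have "t \<in> A2 v" using that(2) A_sub by blast
    ultimately show False using A3D(6)[OF v that(1)] A2D(3)[OF v, of t] by simp
  qed
  have zy: "nx s (nx v s) \<noteq> nx v t" if "s \<in> A3 v" "t \<in> A2 v" for s t
  proof
    assume eq: "nx s (nx v s) = nx v t"
    have t: "t \<in> D2" "t \<in> N v" "s \<in> A2 v" using that A_sub by blast+
    have "t \<in> N (nx s (nx v s))" using A2D(1)[OF v that(2)] eq by auto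
    then have "t = nx v s"
      using A3D(1,6)[OF v that(1)] t by auto
    then show False using A2D(4)[OF v t(3)] t by simp
  qed
  have "nx v s \<noteq> t" if "s \<in> A2 v" "t \<in> A1 v" for s t
    using A2D(4)[OF v that(1)] that(2) A_sub by blast
  moreover have "nx s (nx v s) \<noteq> t" if "s \<in> A3 v" "t \<in> A1 v" for s t
    using A3D(4)[OF v that(1)] that(2) A_sub by blast
  ultimately show ?thesis
    using x yy[of x x'] zz[of x x'] zy[of x x'] zy[of x' x]
    unfolding thread_of_def by (auto split: if_splits)
qed

section \<open>Deleting a vertex with all its threads and coloring it anew\<close>

definition core where "core v = V - {v} - \<Union>(thread_of v ` A1 v)"

lemma core_props:
  assumes v: "v \<in> V" "v \<notin> D2"
  shows "insert v (core v) \<union> \<Union>(thread_of v ` A1 v) = V"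
    "x \<in> A1 v \<Longrightarrow> thread_of v x \<inter> insert v (core v) = {}"
    "x \<in> A1 v \<Longrightarrow> endp v x \<in> core v"
    "N v \<inter> core v \<subseteq> N v - D2" "v \<notin> core v"
proof -
  have D: "thread_of v x \<subseteq> D2" if "x \<in> A1 v" for x using thread_of_D2[OF v(2) that] .
  have DV: "D2 \<subseteq> V" by (auto simp: D2_def)
  show "insert v (core v) \<union> \<Union>(thread_of v ` A1 v) = V"
    using D DV v by (auto simp: core_def)
  show "x \<in> A1 v \<Longrightarrow> thread_of v x \<inter> insert v (core v) = {}"
    using D v by (auto simp: core_def)
  show "x \<in> A1 v \<Longrightarrow> endp v x \<in> core v"
    using D endp_props[OF v(2)] by (auto simp: core_def)
  show "N v \<inter> core v \<subseteq> N v - D2"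
    by (auto simp: core_def A1_def thread_of_def)
  show "v \<notin> core v" by (simp add: core_def)
qed

lemma core_coloring:
  assumes "v \<in> V"
  obtains f where "good N (core v) f {}"
proof -
  have "core v \<subset> V" using assms by (auto simp: core_def)
  then show thesis using smaller[of "core v"] that by blast
qed

lemma color_root:
  assumes v: "v \<in> V" "v \<notin> D2" and f: "good N (core v) f {}" and c: "c < 4"
    and "\<And>u. u \<in> N v - D2 \<Longrightarrow> c \<noteq> f u \<and> c \<noteq> the_elem (oddset N (core v) f u)"
  shows "good N (insert v (core v)) (f(v := c)) {v}"
proof (rule good_insert)
  show "good N (core v) f {v}" using good_mono[OF f] by auto
  show "f u \<noteq> c \<and> (u \<notin> {v} \<longrightarrow> oddset N (core v) f u \<noteq> {c})" if "u \<in> N v \<inter> core v" for u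
    using assms(5)[of u] core_props(4)[OF v] that by force
qed (use c core_props(5)[OF v] in auto)

text \<open>Only a one-vertex thread restricts \<open>f v\<close>, through \<open>thread1\<close>.
  \<open>T\<close> and \<open>S\<close> are general so that one thread can be left out, possibly
  with its last vertex already colored.\<close>

lemma fill_threads:
  assumes v: "v \<in> V" "v \<notin> D2" and T: "T \<subseteq> A1 v"
    and S: "insert v (core v) \<subseteq> S" "\<And>x. x \<in> T \<Longrightarrow> thread_of v x \<inter> S = {}"
    and f: "good N S f {v}" "\<And>x. x \<in> T - A2 v \<Longrightarrow> f v \<noteq> f (endp v x)"
  shows "\<exists>f'. good N (S \<union> \<Union>(thread_of v ` T)) f' {v} \<and> (\<forall>u\<in>S. f' u = f u)"
proof -
  have fin: "finite T" using finite_subset[OF T A_sub(5)] .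
  have disj: "thread_of v x \<inter> thread_of v y = {}" if "x \<in> T" "y \<in> T" "x \<noteq> y" for x y
    using thread_of_disjoint[OF v(2)] that T by blast
  have step: "\<exists>f''. good N (S' \<union> thread_of v x) f'' {v} \<and> (\<forall>u\<in>S'. f'' u = f' u)"
    if x: "x \<in> T" and S': "S \<subseteq> S'" "thread_of v x \<inter> S' = {}"
      and f': "good N S' f' {v}" "\<forall>u\<in>S. f' u = f u" for x S' f'
  proof -
    have x1: "x \<in> A1 v" using x T by auto
    have b: "endp v x \<in> S'" "v \<in> S'" "endp v x \<in> S" "v \<in> S"
      using core_props(3)[OF v x1] S S' by auto
    note X = A1D[OF x1]
    consider "x \<in> A3 v" "x \<in> A2 v" | "x \<notin> A3 v" "x \<in> A2 v" | "x \<notin> A3 v" "x \<notin> A2 v" using A_sub by auto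
    then show "\<exists>f''. good N (S' \<union> thread_of v x) f'' {v} \<and> (\<forall>u\<in>S'. f'' u = f' u)"
    proof cases
      case 1
      let ?y = "nx v x" and ?z = "nx x (nx v x)"
      have i: "thread_of v x = {x, ?y, ?z}" using 1 by (auto simp: thread_of_def)
      have e: "endp v x = nx ?y ?z" using 1 by (simp add: endp_def)
      have "S' \<union> thread_of v x = insert x (insert ?y (insert ?z S'))" using i by auto
      moreover have "\<exists>f''. good N (insert x (insert ?y (insert ?z S'))) f'' {v} \<and> (\<forall>u\<in>S'. f'' u = f' u)"
        by (rule thread3[OF f'(1) _ b(2) b(1)])
          (use X A2D[OF v(2) 1(2)] A3D[OF v(2) 1(1)] S' i e in auto)
      ultimately show ?thesis by simp
    next
      case 2
      let ?y = "nx v x"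
      have i: "thread_of v x = {x, ?y}" using 2 by (auto simp: thread_of_def)
      have e: "endp v x = nx x ?y" using 2 by (simp add: endp_def)
      have "S' \<union> thread_of v x = insert x (insert ?y S')" using i by auto
      moreover have "\<exists>f''. good N (insert x (insert ?y S')) f'' {v} \<and> (\<forall>u\<in>S'. f'' u = f' u)"
        by (rule thread2[OF f'(1) _ b(2) b(1)])
          (use X A2D[OF v(2) 2(2)] S' i e in auto)
      ultimately show ?thesis by simp
    next
      case 3
      have i: "thread_of v x = {x}" using 3 by (auto simp: thread_of_def)
      have e: "endp v x = nx v x" using 3 by (simp add: endp_def)
      have "f' v \<noteq> f' (endp v x)" using f(2)[of x] f'(2) b 3 x by auto
      then have "\<exists>f''. good N (insert x S') f'' {v} \<and> (\<forall>u\<in>S'. f'' u = f' u)"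
        by (intro thread1[OF f'(1) _ b(2) b(1)])
          (use X S' i e in auto)
      then show ?thesis using i by simp
    qed
  qed
  show ?thesis
    using fill[of T S f "{v}" "thread_of v", OF fin f(1) disj S(2) step] .
qed

text \<open>
  The colors that \<open>v\<close> must not get: a neighbour of degree other than 2 rules out its own color
  and its odd color, and a thread with one vertex rules out the color of its far end.
\<close>

definition blocked where
  "blocked v f = f ` (N v - D2) \<union> (\<lambda>u. the_elem (oddset N (core v) f u)) ` (N v - D2) \<union>
     (\<lambda>x. f (endp v x)) ` (A1 v - A2 v)"

lemma blocked_card:
  "finite (blocked v f)"
  "card (blocked v f) \<le> 2 * card (N v - D2) + card (A1 v - A2 v)"
proof -
  have fin: "finite (N v - D2)" "finite (A1 v - A2 v)" using finN[of v] A_sub(5)[of v] by simp_all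
  then show "finite (blocked v f)" by (simp add: blocked_def)
  show "card (blocked v f) \<le> 2 * card (N v - D2) + card (A1 v - A2 v)"
    unfolding blocked_def
    by (rule order_trans[OF card_Un_le])
      (use card_Un_le[of "f ` (N v - D2)" "(\<lambda>u. the_elem (oddset N (core v) f u)) ` (N v - D2)"]
        card_image_le[OF fin(1), of f]
        card_image_le[OF fin(1), of "\<lambda>u. the_elem (oddset N (core v) f u)"]
        card_image_le[OF fin(2), of "\<lambda>x. f (endp v x)"] in linarith)
qed

text \<open>At most three colors are blocked, so \<open>v\<close> gets a color; odd degree settles
  its parity once all threads are filled.\<close>

lemma odd_not_sparse:
  assumes v: "v \<in> V" "v \<notin> D2" and d: "odd (card (N v))"
    and s: "2 * card (N v - D2) + card (A1 v - A2 v) \<le> 3"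
  shows False
proof -
  obtain f where f: "good N (core v) f {}" using core_coloring[OF v(1)] .
  obtain c where c: "c < 4" "c \<notin> blocked v f"
    using pick_color[of "blocked v f"] blocked_card[of v f] s by auto
  have g: "good N (insert v (core v)) (f(v := c)) {v}"
    by (rule color_root[OF v f c(1)]) (use c in \<open>auto simp: blocked_def\<close>)
  have "\<exists>f'. good N (insert v (core v) \<union> \<Union>(thread_of v ` A1 v)) f' {v} \<and>
      (\<forall>u\<in>insert v (core v). f' u = (f(v := c)) u)"
    by (rule fill_threads[OF v _ _ _ g])
      (use core_props[OF v] c endp_props[OF v(2)] in \<open>auto simp: blocked_def\<close>)
  then obtain f' where f': "good N V f' {v}" using core_props(1)[OF v] by auto
  have "N v \<inter> V = N v" using N_V by auto
  then have "oddset N V f' v \<noteq> {}"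
    using oddset_odd_card[of N v V f'] finN good_lt[OF f'] d by auto
  then show False using good_drop[OF f'] not_good by auto
qed

text \<open>At most two blocked colors leave room to avoid the odd color of the far end
  \<open>b\<close> as well. Then \<open>z\<close> can be colored so that
  \<open>finish_thread\<close> applies to \<open>x\<close>, \<open>y\<close> with \<open>z\<close>
  as far end.\<close>

lemma no_thread3_if_sparse:
  assumes v: "v \<in> V" "v \<notin> D2" and x: "x \<in> A3 v"
    and s: "2 * card (N v - D2) + card (A1 v - A2 v) \<le> 2"
  shows False
proof -
  define y z b where "y = nx v x" and "z = nx x y" and "b = nx y z"
  have x2: "x \<in> A2 v" and x1: "x \<in> A1 v" using x A_sub by auto
  note X = A1D[OF x1, folded y_def] A2D[OF v(2) x2, folded y_def, folded z_def]
    A3D[OF v(2) x, folded y_def, folded z_def, folded b_def]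
  have i: "thread_of v x = {x, y, z}" and e: "endp v x = b"
    using x x2 by (auto simp: thread_of_def endp_def y_def z_def b_def)
  have b: "b \<in> core v" using core_props(3)[OF v x1] e by simp
  \<comment> \<open>Adjacency of \<open>v\<close> and \<open>b\<close> would close a 5-cycle; hence
    coloring \<open>v\<close> does not change the odd set of \<open>b\<close>.\<close>
  have vb: "v \<notin> N b" using no_pentagon[of x v y z b] X by auto
  obtain f where f: "good N (core v) f {}" using core_coloring[OF v(1)] .
  have "card (insert (the_elem (oddset N (core v) f b)) (blocked v f)) < 4"
    using blocked_card[of v f] s by (simp add: card_insert_if)
  moreover have "finite (insert (the_elem (oddset N (core v) f b)) (blocked v f))"
    using blocked_card(1) by simp
  ultimately obtain c where
    c: "c < 4" "c \<notin> blocked v f" "c \<noteq> the_elem (oddset N (core v) f b)"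
    using pick_color by blast
  let ?f = "f(v := c)" and ?S = "insert v (core v)"
  have g0: "good N ?S ?f {v}"
    by (rule color_root[OF v f c(1)]) (use c in \<open>auto simp: blocked_def\<close>)
  have ob: "oddset N ?S ?f b = oddset N (core v) f b"
    using oddset_ins[OF core_props(5)[OF v], of f c b] vb by simp
  \<comment> \<open>With such a color for \<open>z\<close>, the thread \<open>v - x - y - z\<close> satisfies \<open>finish_thread\<close>.\<close>
  obtain k where k: "k < 4" "k \<noteq> f b" "oddset N (core v) f b \<noteq> {k}" "k = c \<or> f b = c"
  proof (cases "f b = c")
    case True
    obtain k where "k < 4" "k \<noteq> f b" "k \<noteq> the_elem (oddset N (core v) f b)"
      using pick_color3 .
    then show thesis using True by (intro that[of k]) auto
  next
    case False
    moreover have "oddset N (core v) f b \<noteq> {c}" using c(3) by force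
    ultimately show thesis by (intro that[of c]) (use c in simp_all)
  qed
  let ?g = "?f(z := k)" and ?T = "insert z ?S"
  have xyz: "x \<notin> ?S" "y \<notin> ?S" "z \<notin> ?S" using core_props(2)[OF v x1] i by auto
  have g1: "good N ?T ?g {v}"
    by (rule add_leaf[OF g0, of z b]) (use xyz X b k ob in auto)
  have disj: "thread_of v t \<inter> {x, y, z} = {}" if "t \<in> A1 v - {x}" for t
    using thread_of_disjoint[OF v(2), of t x] that x1 i by auto
  have zD: "z \<noteq> endp v t" if "t \<in> A1 v" for t
    using endp_props(1)[OF v(2) that] X by auto
  have "\<exists>f'. good N (?T \<union> \<Union>(thread_of v ` (A1 v - {x}))) f' {v} \<and> (\<forall>u\<in>?T. f' u = ?g u)"
  proof (rule fill_threads[OF v _ _ _ g1])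
    show "thread_of v t \<inter> ?T = {}" if "t \<in> A1 v - {x}" for t
      using disj[OF that] core_props(2)[OF v, of t] that by auto
    show "?g v \<noteq> ?g (endp v t)" if "t \<in> A1 v - {x} - A2 v" for t
      using that zD[of t] endp_props(3)[OF v(2), of t] c(2) xyz by (auto simp: blocked_def)
  qed auto
  then obtain f' where f': "good N (?T \<union> \<Union>(thread_of v ` (A1 v - {x}))) f' {v}"
    "\<forall>u\<in>?T. f' u = ?g u" by blast
  let ?U = "?T \<union> \<Union>(thread_of v ` (A1 v - {x}))"
  have xy: "x \<notin> ?U" "y \<notin> ?U" using disj xyz X by auto
  have "A1 v = insert x (A1 v - {x})" using x1 by auto
  then have "\<Union>(thread_of v ` A1 v) = {x, y, z} \<union> \<Union>(thread_of v ` (A1 v - {x}))"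
    using i by (metis Union_image_insert)
  then have U: "insert x (insert y ?U) = V"
    using core_props(1)[OF v] by auto
  have oz: "oddset N ?U f' z = {f' b}"
    by (rule oddset_single) (use X xy b in auto)
  have vals: "f' v = c" "f' z = k" "f' b = f b" using f'(2) xyz b X by auto
  have "\<exists>f''. good N (insert x (insert y ?U)) f'' {}"
    by (rule finish_thread[OF f'(1), of z]) (use X xy oz vals k in auto)
  then show False using U not_good by auto
qed

text \<open>Nothing is blocked, so \<open>v\<close> may take the color of the far end
  \<open>b\<close> of one thread. By \<open>no_thread3_if_sparse\<close> this thread has just two
  vertices, and \<open>finish_thread\<close> applies with equal colors at \<open>v\<close> and
  \<open>b\<close>.\<close>

lemma all_long_threads:
  assumes v: "v \<in> V" "v \<notin> D2" "N v - D2 = {}" "A1 v = A2 v" "A1 v \<noteq> {}"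
  shows False
proof -
  have no3: "A3 v = {}"
    using no_thread3_if_sparse[OF v(1,2)] v by auto
  obtain x where x1: "x \<in> A1 v" and x2: "x \<in> A2 v" using v by auto
  define y b where "y = nx v x" and "b = nx x y"
  note X = A1D[OF x1, folded y_def] A2D[OF v(2) x2, folded y_def, folded b_def]
  have i: "thread_of v x = {x, y}" and e: "endp v x = b"
    using x2 no3 by (auto simp: thread_of_def endp_def y_def b_def)
  note core = core_props[OF v(1,2)]
  have b: "b \<in> core v" using core(3)[OF x1] e by simp
  obtain f where f: "good N (core v) f {}" using core_coloring[OF v(1)] .
  let ?f = "f(v := f b)" and ?S = "insert v (core v)"
  have g0: "good N ?S ?f {v}"
    by (rule color_root[OF v(1,2) f]) (use v good_lt[OF f b] in auto)
  have disj: "thread_of v t \<inter> {x, y} = {}" if "t \<in> A1 v - {x}" for t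
    using thread_of_disjoint[OF v(2), of t x] that x1 i by auto
  have "\<exists>f'. good N (?S \<union> \<Union>(thread_of v ` (A1 v - {x}))) f' {v} \<and> (\<forall>u\<in>?S. f' u = ?f u)"
    by (rule fill_threads[OF v(1,2) _ _ _ g0]) (use core(2) v in auto)
  then obtain f' where f': "good N (?S \<union> \<Union>(thread_of v ` (A1 v - {x}))) f' {v}"
    "\<forall>u\<in>?S. f' u = ?f u" by blast
  let ?U = "?S \<union> \<Union>(thread_of v ` (A1 v - {x}))"
  have xy: "x \<notin> ?U" "y \<notin> ?U" using disj core(2)[OF x1] i by auto
  have "A1 v = insert x (A1 v - {x})" using x1 by auto
  then have "\<Union>(thread_of v ` A1 v) = {x, y} \<union> \<Union>(thread_of v ` (A1 v - {x}))"
    using i by (metis Union_image_insert)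
  then have U: "insert x (insert y ?U) = V"
    using core(1) by auto
  have vals: "f' v = f' b" using f'(2) b X by auto
  have "\<exists>f''. good N (insert x (insert y ?U)) f'' {}"
    by (rule finish_thread[OF f'(1), of b]) (use X xy vals b in auto)
  then show False using U not_good by auto
qed

section \<open>Discharging\<close>

text \<open>The sum of the three cardinalities counts the 2-vertices on threads at \<open>v\<close>,
  each costing charge 2.\<close>

lemma charge_bound:
  assumes v: "v \<in> V" "v \<notin> D2"
  shows "2 * (card (A1 v) + card (A2 v) + card (A3 v)) + 22 \<le> 9 * card (N v)"
proof -
  define d n0 n1 a1 a2 a3 where "d = card (N v)" and "n0 = card (N v - D2)"
    and "n1 = card (A1 v - A2 v)" and "a1 = card (A1 v)" and "a2 = card (A2 v)"
    and "a3 = card (A3 v)"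
  note defs = d_def n0_def n1_def a1_def a2_def a3_def
  have fin: "finite (A1 v)" "finite (A2 v)" "finite (A3 v)"
    using A_sub finite_subset[of "A2 v" "A1 v"] finite_subset[of "A3 v" "A2 v"] by blast+
  have d3: "d \<ge> 3"
    using no_small[OF v(1)] v by (auto simp: D2_def d_def)
  have "N v = A1 v \<union> (N v - D2)" by (auto simp: A1_def)
  moreover have "A1 v \<inter> (N v - D2) = {}" by (auto simp: A1_def)
  ultimately have "card (N v) = card (A1 v) + card (N v - D2)"
    using card_Un_disjoint[OF fin(1), of "N v - D2"] finN[of v] by simp
  then have d: "d = a1 + n0" by (simp add: defs)
  have a1: "a1 = n1 + a2"
    using card_Diff_subset[OF fin(2) A_sub(2)] card_mono[OF fin(1) A_sub(2)] by (simp add: defs)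
  have a3: "a3 \<le> a2"
    using card_mono[OF fin(2) A_sub(1)] by (simp add: defs)
  have "2 * (a1 + a2 + a3) + 22 \<le> 9 * d"
  proof (cases "odd d")
    case True
    have "A2 v = {}"
    proof (rule equals0I)
      fix x assume x2: "x \<in> A2 v"
      then have x1: "x \<in> A1 v" using A_sub by blast
      note x = A1D[OF x1] A2D[OF v(2) x2]
      show False
        using odd_no_thread2[of v x "nx v x" "nx x (nx v x)"] True x(1,2) x(7,8) by (metis d_def)
    qed
    then have a2: "a2 = 0" by (simp add: a2_def)
    have s: "4 \<le> 2 * n0 + n1"
      using odd_not_sparse[OF v] True by (fastforce simp: d_def n0_def n1_def)
    have "d \<noteq> 4" using True by auto
    show ?thesis
    \<comment> \<open>For \<open>d = 3\<close> the charge 27 - 22 = 5 pays for two 2-vertices, and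
      \<open>s\<close> excludes three.\<close>
    proof (cases "d = 3")
      case True
      then have "a1 \<le> 2" using a2 s d a1 by linarith
      then show ?thesis using True a2 a3 by simp
    next
      case False
      then have "d \<ge> 5" using d3 \<open>d \<noteq> 4\<close> by linarith
      then show ?thesis using a2 d a1 a3 by simp
    qed
  next
    case False
    have sparse: "a3 = 0 \<or> 2 * n0 + n1 \<ge> 3"
    proof (rule ccontr)
      assume *: "\<not> ?thesis"
      then have "A3 v = {}" using no_thread3_if_sparse[OF v] by (auto simp: n0_def n1_def)
      then show False using * by (simp add: a3_def)
    qed
    have short: "n0 \<ge> 1 \<or> n1 \<ge> 1"
    proof (rule ccontr)
      assume "\<not> ?thesis"
      then have 0: "n0 = 0" "n1 = 0" by auto
      then have "N v - D2 = {}" "A1 v - A2 v = {}"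
        using finN[of v] fin(1) by (simp_all add: n0_def n1_def)
      moreover have "A1 v \<noteq> {}"
      proof
        assume "A1 v = {}"
        then show False using d3 d 0 by (simp add: a1_def)
      qed
      ultimately show False using all_long_threads[OF v] A_sub(2)[of v] by blast
    qed
    have "d \<noteq> 3" "d \<noteq> 5" "d \<noteq> 7" using False by auto
    \<comment> \<open>With at most three vertices per thread, \<open>6 * d + 22 \<le> 9 * d\<close>
      settles \<open>d \<ge> 8\<close>. For \<open>d = 4\<close> and \<open>d = 6\<close> the charge
      is 14 and 32, which pays for 7 and 16 vertices.\<close>
    then consider "d = 4" | "d = 6" | "d \<ge> 8" using d3 by linarith
    then show ?thesis
    proof cases
      case 1
      from sparse have "a1 + a2 + a3 \<le> 7"
      proof
        assume "a3 = 0"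
        with short show ?thesis using 1 d a1 by (elim disjE) linarith+
      next
        assume "2 * n0 + n1 \<ge> 3"
        then show ?thesis using 1 d a1 a3 by linarith
      qed
      with 1 show ?thesis by simp
    next
      case 2
      from short have "a1 + a2 + a3 \<le> 16"
        using 2 d a1 a3 by (elim disjE) linarith+
      with 2 show ?thesis by simp
    next
      case 3
      then show ?thesis using d a1 a3 by simp
    qed
  qed
  then show ?thesis by (simp add: defs)
qed

text \<open>
  A 2-vertex \<open>w\<close> receives charge along both its edges: in the direction of \<open>p\<close>, from the vertex
  \<open>v\<close> at that end of its thread.
\<close>

lemma dart_root:
  assumes w: "w \<in> D2" and p: "p \<in> N w"
  shows "\<exists>v \<in> V - D2. (w, p) \<in> (\<lambda>x. (x, v)) ` A1 v \<union> (\<lambda>x. (nx v x, x)) ` A2 v \<union>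
    (\<lambda>x. (nx x (nx v x), nx v x)) ` A3 v"
proof (cases "p \<in> D2")
  case False
  then have "p \<in> V - D2" "w \<in> A1 p"
    using N_V p N_sym[OF p] w by (auto simp: A1_def)
  then show ?thesis by blast
next
  case p2: True
  define q where "q = nx w p"
  have Np: "N p = {w, q}" "q \<noteq> w" using nx_ends[OF p2 N_sym[OF p]] by (auto simp: q_def)
  have qw: "nx q p = w" using nx_eq[of p q w] Np by auto
  have pq: "p \<in> N q" using N_sym[of q p] Np by auto
  show ?thesis
  proof (cases "q \<in> D2")
    case False
    have "q \<in> V - D2" using False N_V[of q p] Np by auto
    moreover have "p \<in> A2 q" using pq p2 qw w by (simp add: A1_def A2_def)
    ultimately show ?thesis using qw by force
  next
    case q2: True
    define r where "r = nx p q"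
    have Nq: "N q = {p, r}" "r \<noteq> p" using nx_ends[OF q2 pq] by (auto simp: r_def)
    have rp: "nx r q = p" using nx_eq[of q r p] Nq by auto
    have qr: "q \<in> N r" using N_sym[of r q] Nq by auto
    have "r \<notin> D2"
    proof
      assume r2: "r \<in> D2"
      have Nr: "N r = {q, nx q r}" "nx q r \<noteq> q" using nx_ends[OF r2 qr] .
      have Nw: "N w = {p, nx p w}" "nx p w \<noteq> p" using nx_ends[OF w p] .
      show False
        using no_thread4[of r "nx q r" q p w "nx p w"] Nr Nq Np Nw by (auto simp: insert_commute)
    qed
    then have "r \<in> V - D2" using N_V[of r q] Nq by auto
    moreover have "q \<in> A3 r" using qr q2 rp p2 qw w by (simp add: A1_def A2_def A3_def)
    ultimately show ?thesis using rp qw by force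
  qed
qed

text \<open>A 2-vertex has charge 18 - 22 = -4 and gets 2 along each of its two edges. These darts
  are covered by the sets \<open>im v\<close>, whose sizes \<open>charge_bound\<close>
  controls.\<close>

lemma dense: "22 * card V \<le> 9 * (\<Sum>v\<in>V. card (N v))"
proof -
  \<comment> \<open>The darts that \<open>v\<close> pays for: the vertices on its threads, each
    paired with its neighbour towards \<open>v\<close>.\<close>
  define im where "im v = (\<lambda>x. (x, v)) ` A1 v \<union> (\<lambda>x. (nx v x, x)) ` A2 v \<union>
    (\<lambda>x. (nx x (nx v x), nx v x)) ` A3 v" for v
  define B where "B = V - D2"
  have fA: "finite (A1 v)" "finite (A2 v)" "finite (A3 v)" for v
    using A_sub finite_subset[of "A2 v" "A1 v"] finite_subset[of "A3 v" "A2 v"] by blast+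
  have D: "D2 \<subseteq> V" "finite D2" "finite B" "D2 \<inter> B = {}" "V = D2 \<union> B"
    using finV finite_subset[of D2 V] by (auto simp: D2_def B_def)
  have im: "card (im v) \<le> card (A1 v) + card (A2 v) + card (A3 v)" for v
  proof -
    have "card (im v) \<le> card ((\<lambda>x. (x, v)) ` A1 v) + card ((\<lambda>x. (nx v x, x)) ` A2 v) +
        card ((\<lambda>x. (nx x (nx v x), nx v x)) ` A3 v)"
      unfolding im_def using card_Un_le order_trans add_right_mono by meson
    then show ?thesis
      using card_image_le[OF fA(1)[of v], of "\<lambda>x. (x, v)"]
        card_image_le[OF fA(2)[of v], of "\<lambda>x. (nx v x, x)"]
        card_image_le[OF fA(3)[of v], of "\<lambda>x. (nx x (nx v x), nx v x)"] by linarith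
  qed
  have "Sigma D2 N \<subseteq> \<Union>(im ` B)"
    using dart_root by (fastforce simp: im_def B_def)
  moreover have "finite (\<Union>(im ` B))" using D fA by (auto simp: im_def)
  ultimately have "card (Sigma D2 N) \<le> card (\<Union>(im ` B))" by (rule card_mono[rotated])
  also have "\<dots> \<le> (\<Sum>v\<in>B. card (im v))" by (rule card_UN_le[OF D(3)])
  also have "\<dots> \<le> (\<Sum>v\<in>B. card (A1 v) + card (A2 v) + card (A3 v))"
    by (rule sum_mono) (rule im)
  finally have darts: "card (Sigma D2 N) \<le> (\<Sum>v\<in>B. card (A1 v) + card (A2 v) + card (A3 v))" .
  have deg2: "(\<Sum>v\<in>D2. card (N v)) = 2 * card D2"
    by (simp add: D2_def)
  have "card (Sigma D2 N) = 2 * card D2"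
    using card_SigmaI[of D2 N] D finN deg2 by simp
  with darts have "2 * (2 * card D2) \<le> 2 * (\<Sum>v\<in>B. card (A1 v) + card (A2 v) + card (A3 v))"
    by simp
  moreover have "(\<Sum>v\<in>B. 2 * (card (A1 v) + card (A2 v) + card (A3 v)) + 22) \<le>
      (\<Sum>v\<in>B. 9 * card (N v))"
    by (rule sum_mono) (use charge_bound in \<open>auto simp: B_def\<close>)
  then have "2 * (\<Sum>v\<in>B. card (A1 v) + card (A2 v) + card (A3 v)) + 22 * card B \<le>
      9 * (\<Sum>v\<in>B. card (N v))"
    by (simp only: sum.distrib[of _ "\<lambda>_. 22"] sum_distrib_left[symmetric] sum_constant) simp
  moreover have "(\<Sum>v\<in>V. card (N v)) = 2 * card D2 + (\<Sum>v\<in>B. card (N v))"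
    using sum.union_disjoint[OF D(2,3,4), of "\<lambda>v. card (N v)"] D(5) deg2 by simp
  moreover have "card V = card D2 + card B"
    using card_Un_disjoint[OF D(2,3,4)] D(5) by simp
  ultimately show ?thesis by linarith
qed

end

text \<open>A minimal set without a good coloring would be critical and so violate the sparsity
  bound by \<open>dense\<close>. Sparsity is assumed for all \<open>S\<close> because that set can
  be a proper subset of \<open>V\<close>.\<close>

lemma (in sgraph) sparse_good:
  assumes C5: "\<And>a b c d e. \<lbrakk>distinct [a, b, c, d, e]; b \<in> N a; c \<in> N b; d \<in> N c; e \<in> N d;
      a \<in> N e; c \<notin> N a; d \<notin> N a; d \<notin> N b; e \<notin> N b; e \<notin> N c\<rbrakk> \<Longrightarrow> False"
    and sparse: "\<And>S. S \<subseteq> V \<Longrightarrow> S \<noteq> {} \<Longrightarrow> 9 * (\<Sum>u\<in>S. card (N u \<inter> S)) < 22 * card S"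
  shows "\<exists>f. good N V f {}"
proof -
  have "\<exists>f. good N S f {}" if "S \<subseteq> V" for S
    using finite_subset[OF that finV] that
  proof (induction S rule: finite_psubset_induct)
    case (psubset S)
    show ?case
    proof (rule ccontr)
      assume no: "\<nexists>f. good N S f {}"
      \<comment> \<open>Emptied outside \<open>S\<close>, since the locale axioms ask for symmetry
        and for neighbours in \<open>S\<close> at every element of the type.\<close>
      define M where "M u = (if u \<in> S then N u \<inter> S else {})" for u
      have eq: "good M T f X = good N T f X" if "T \<subseteq> S" for T f X
      proof -
        have M: "M u \<inter> T = N u \<inter> T" if "u \<in> T" for u
          using that \<open>T \<subseteq> S\<close> by (auto simp: M_def)
        then have "oddset M T f u = oddset N T f u" if "u \<in> T" for u
          using that by (simp add: oddset_def)
        with M show ?thesis unfolding good_def by auto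
      qed
      interpret H: critical S M
      proof
        show "finite S" by fact
        show "u \<in> M v \<Longrightarrow> u \<in> S" "u \<in> M v \<Longrightarrow> v \<in> M u" "v \<notin> M v" for u v
          using N_sym[of u v] N_irrefl by (auto simp: M_def split: if_splits)
        show "\<exists>f. good M T f {}" if "T \<subset> S" for T
          using psubset.IH[OF that] psubset.prems eq[of T] that by auto
        show "\<not> good M S f {}" for f using no eq[of S] by auto
        show False if "distinct [a, b, c, d, e]" "b \<in> M a" "c \<in> M b" "d \<in> M c" "e \<in> M d"
          "a \<in> M e" "c \<notin> M a" "d \<notin> M a" "d \<notin> M b" "e \<notin> M b" "e \<notin> M c" for a b c d e
          using C5[of a b c d e] that by (auto simp: M_def split: if_splits)
      qed
      have "S \<noteq> {}" using no by (auto simp: good_def)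
      moreover have "(\<Sum>u\<in>S. card (M u)) = (\<Sum>u\<in>S. card (N u \<inter> S))"
        by (simp add: M_def)
      ultimately show False using H.dense sparse[OF psubset.prems] by simp
    qed
  qed
  then show ?thesis by blast
qed

section \<open>Translation to the graph \<open>G\<close>\<close>

lemma induced_pentagon:
  assumes G: "simple_graph G" and d: "distinct [a, b, c, d, e]"
    and E: "{a, b} \<in> edges G" "{b, c} \<in> edges G" "{c, d} \<in> edges G" "{d, e} \<in> edges G"
      "{e, a} \<in> edges G"
    and nE: "{a, c} \<notin> edges G" "{a, d} \<notin> edges G" "{b, d} \<notin> edges G" "{b, e} \<notin> edges G"
      "{c, e} \<notin> edges G"
  shows "\<exists>H. induced_subgraph H G \<and> isomorphic H (cycle_graph 5)"
proof -
  let ?V = "{a, b, c, d, e}"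
  let ?H = "\<lparr>verts = ?V, edges = {x \<in> edges G. x \<subseteq> ?V}\<rparr>"
  define f where "f x = (if x = a then 0 else if x = b then 1 else if x = c then 2
    else if x = d then 3 else 4 :: nat)" for x
  have f: "f a = 0" "f b = 1" "f c = 2" "f d = 3" "f e = 4"
    using d by (auto simp: f_def)
  have five: "{..<5} = {0, 1, 2, 3, 4 :: nat}" by auto
  have edges: "{x \<in> edges G. x \<subseteq> ?V} = {{a, b}, {b, c}, {c, d}, {d, e}, {e, a}}" (is "?L = ?R")
  proof
    show "?R \<subseteq> ?L" using E by auto
    show "?L \<subseteq> ?R"
    proof
      fix x assume x: "x \<in> ?L"
      then have "card x = 2" using G by (auto simp: simple_graph_def)
      then obtain s t where st: "x = {s, t}" "s \<noteq> t" by (auto simp: card_2_iff)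
      have "s \<in> ?V" "t \<in> ?V" "{s, t} \<in> edges G" using x st by auto
      then have "{s, t} \<in> ?R"
        using nE st(2) by (elim insertE emptyE) (simp_all add: insert_commute)
      then show "x \<in> ?R" using st by simp
    qed
  qed
  have "{{i, (i + 1) mod 5} | i. i < 5} = (\<lambda>i. {i, (i + 1) mod 5}) ` {..<5 :: nat}" by auto
  also have "\<dots> = {{0, 1}, {1, 2}, {2, 3}, {3, 4}, {4, 0}}" unfolding five by (simp add: numeral_2_eq_2)
  finally have C: "edges (cycle_graph 5) = {{0, 1}, {1, 2}, {2, 3}, {3, 4}, {4, 0}}"
    by (simp add: cycle_graph_def)
  have "bij_betw f ?V {..<5}"
    unfolding bij_betw_def five using d f by (auto simp: inj_on_def)
  moreover have "(\<lambda>x. f ` x) ` {{a, b}, {b, c}, {c, d}, {d, e}, {e, a}} = edges (cycle_graph 5)"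
    unfolding C by (simp add: f)
  ultimately have "isomorphic ?H (cycle_graph 5)"
    unfolding isomorphic_def using edges by (intro exI[of _ f]) (simp add: cycle_graph_def)
  moreover have "induced_subgraph ?H G"
    using G E by (fastforce simp: induced_subgraph_def simple_graph_def)
  ultimately show ?thesis by blast
qed

text \<open>Every edge inside \<open>S\<close> comes from at most two ordered pairs of adjacent
  vertices.\<close>

lemma degree_sum_le:
  assumes G: "simple_graph G" and S: "S \<subseteq> verts G"
  shows "(\<Sum>u\<in>S. card (neighbourhood G u \<inter> S)) \<le> 2 * card {x \<in> edges G. x \<subseteq> S}"
proof -
  let ?E = "{x \<in> edges G. x \<subseteq> S}"
  have finS: "finite S" using G S finite_subset by (auto simp: simple_graph_def)
  have finE: "finite ?E" by (rule finite_subset[of _ "Pow S"]) (use finS in auto)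
  define ar where "ar x = {(u, w) \<in> S \<times> S. {u, w} = x}" for x
  have ar: "finite (ar x)" "card (ar x) \<le> 2" if "x \<in> ?E" for x
  proof -
    have "card x = 2" using that G by (auto simp: simple_graph_def)
    then obtain p q where "x = {p, q}" by (auto simp: card_2_iff)
    then have sub: "ar x \<subseteq> {(p, q), (q, p)}" by (auto simp: ar_def doubleton_eq_iff)
    then show "finite (ar x)" using finite_subset by blast
    have "card (ar x) \<le> card {(p, q), (q, p)}" by (rule card_mono[OF _ sub]) simp
    also have "\<dots> \<le> 2" using card_length[of "[(p, q), (q, p)]"] by simp
    finally show "card (ar x) \<le> 2" .
  qed
  have "(\<Sum>u\<in>S. card (neighbourhood G u \<inter> S)) = card (Sigma S (\<lambda>u. neighbourhood G u \<inter> S))"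
    using finS by (simp add: card_SigmaI)
  also have "\<dots> \<le> card (\<Union>(ar ` ?E))"
    by (rule card_mono) (use finE ar in \<open>auto simp: ar_def neighbourhood_def insert_commute\<close>)
  also have "\<dots> \<le> (\<Sum>x\<in>?E. card (ar x))" by (rule card_UN_le[OF finE])
  also have "\<dots> \<le> (\<Sum>x\<in>?E. 2)" by (rule sum_mono) (rule ar(2))
  finally show ?thesis by simp
qed

text \<open>The subgraph induced by \<open>S\<close> is one of those over which \<open>mad\<close>
  takes the maximum.\<close>

lemma mad_bound:
  assumes G: "simple_graph G" and S: "S \<subseteq> verts G" "S \<noteq> {}"
  shows "real (\<Sum>u\<in>S. card (neighbourhood G u \<inter> S)) \<le> mad G * real (card S)"
proof -
  let ?H = "\<lparr>verts = S, edges = {x \<in> edges G. x \<subseteq> S}\<rparr>"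
  have "finite S" using G S finite_subset by (auto simp: simple_graph_def)
  then have pos: "card S > 0" using S by (simp add: card_gt_0_iff)
  have "subgraph ?H G"
    using G S \<open>finite S\<close> by (auto simp: subgraph_def simple_graph_def)
  then have "2 * real (card (edges ?H)) / real (card (verts ?H)) \<le> mad G"
    unfolding mad_def
    by (intro Max_ge[OF finite_mad_set[OF G]] CollectI exI[of _ ?H]) (use S in simp)
  then have "2 * real (card {x \<in> edges G. x \<subseteq> S}) \<le> mad G * real (card S)"
    using pos by (simp add: field_simps)
  moreover have "real (\<Sum>u\<in>S. card (neighbourhood G u \<inter> S)) \<le> 2 * real (card {x \<in> edges G. x \<subseteq> S})"
    using degree_sum_le[OF G S(1)] by linarith
  ultimately show ?thesis by linarith
qed

lemma good_imp_odd_coloring: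
  assumes G: "simple_graph G" and g: "good (neighbourhood G) (verts G) f {}"
  shows "odd_coloring G 4 f"
proof -
  have N: "neighbourhood G v \<inter> verts G = neighbourhood G v" for v
    by (auto simp: neighbourhood_def)
  have lt: "f v < 4" if "v \<in> verts G" for v using good_lt[OF g that] .
  have "f u \<noteq> f v" if "u \<in> verts G" "v \<in> verts G" "{u, v} \<in> edges G" for u v
  proof -
    have "v \<in> neighbourhood G u" using that by (simp add: neighbourhood_def insert_commute)
    then show ?thesis using g that unfolding good_def N by blast
  qed
  moreover have "\<exists>k < 4. odd (card {u \<in> neighbourhood G v. f u = k})"
    if v: "v \<in> verts G" "degree G v > 0" for v
  proof -
    have "neighbourhood G v \<noteq> {}" using v by (auto simp: degree_def)
    then have "oddset (neighbourhood G) (verts G) f v \<noteq> {}"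
      using g v N unfolding good_def by auto
    then obtain k where k: "odd (card {u \<in> neighbourhood G v. f u = k})"
      unfolding oddset_def N by blast
    then have "{u \<in> neighbourhood G v. f u = k} \<noteq> {}" by (metis card.empty even_zero)
    then have "k < 4" using lt by (auto simp: neighbourhood_def)
    with k show ?thesis by blast
  qed
  ultimately show ?thesis
    using lt by (auto simp: odd_coloring_def proper_coloring_def)
qed

theorem theorem1p3:
  fixes G :: "'a ugraph"
  assumes "simple_graph G"
    and "mad G < 22 / 9"
    and "\<not> (\<exists>H. induced_subgraph H G \<and> isomorphic H (cycle_graph 5))"
  shows "odd_chromatic_number G \<le> 4"
proof -
  let ?N = "neighbourhood G"
  have in_V: "{u, v} \<in> edges G \<Longrightarrow> u \<in> verts G \<and> v \<in> verts G" for u v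
    using assms(1) by (auto simp: simple_graph_def)
  have N: "u \<in> ?N v \<longleftrightarrow> {v, u} \<in> edges G" for u v
    using in_V[of u v] by (auto simp: neighbourhood_def insert_commute)
  interpret sgraph "verts G" ?N
  proof
    show "finite (verts G)" using assms(1) by (simp add: simple_graph_def)
    show "v \<notin> ?N v" for v using assms(1) by (auto simp: N simple_graph_def)
    show "u \<in> ?N v \<Longrightarrow> v \<in> ?N u" for u v by (simp add: N insert_commute)
  qed (simp add: neighbourhood_def)
  have "\<exists>f. good ?N (verts G) f {}"
  proof (rule sparse_good)
    show False if "distinct [a, b, c, d, e]" "b \<in> ?N a" "c \<in> ?N b" "d \<in> ?N c" "e \<in> ?N d"
      "a \<in> ?N e" "c \<notin> ?N a" "d \<notin> ?N a" "d \<notin> ?N b" "e \<notin> ?N b" "e \<notin> ?N c" for a b c d e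
      using induced_pentagon[OF assms(1) that(1)] that assms(3) by (simp add: N)
    \<comment> \<open>\<open>S\<close> is nonempty, so \<open>verts G\<close> is too and
      \<open>mad G\<close> is a genuine maximum.\<close>
    show "9 * (\<Sum>u\<in>S. card (?N u \<inter> S)) < 22 * card S" if S: "S \<subseteq> verts G" "S \<noteq> {}" for S
    proof -
      have "card S > 0" using S finV finite_subset[of S] by (simp add: card_gt_0_iff)
      then have "mad G * real (card S) < 22 / 9 * real (card S)" using assms(2) by simp
      then have "real (\<Sum>u\<in>S. card (?N u \<inter> S)) < 22 / 9 * real (card S)"
        using mad_bound[OF assms(1) S] by linarith
      then show ?thesis by linarith
    qed
  qed
  then show ?thesis
    using good_imp_odd_coloring[OF assms(1)] unfolding odd_chromatic_number_def
    by (blast intro: Least_le)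
qed

end
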